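(* Let $n,h,\lambda,k,r_1,\dots,r_k$ be positive integers with $n>h$ such that $r_i\ge 2$ and $h$ divides $r_in$ for $1\le i\le k$, and $\sum_{i=1}^k r_i=\lambda\binom{n-1}{h-1}$. Then for every integer $\ell$ with $1\le\ell\le n$ there exists an $h$-uniform hypergraph $\mathcal G$ on an $\ell$-element vertex set $V$ containing a distinguished vertex $\alpha$, together with a $k$-edge-coloring, such that: (1) for $u\in V$ and $1\le i\le k$, $d_i(u)=r_i(n-\ell+1)$ if $u=\alpha$ and $d_i(u)=r_i$ if $u\ne\alpha$; (2) for every integer $p\ge 0$ and every subset $U\subseteq V\setminus\{\alpha\}$ with $|U|=h-p$, the number of edges of $\mathcal G$ equal to the multiset $\{\alpha^p\}\cup U$ is $\lambda\binom{n-\ell+1}{p}$; (3) for $1\le i\le k$, if $r_i\ge 2$ then $\mathcal G_i$ is connected.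
   Context: A hypergraph is a pair $(V,E)$, $V$ finite, $E$ a multiset of edges, each edge a multi-subset of $V$ (a vertex may occur several times in an edge). It is $h$-uniform if every edge has size $h$ counted with multiplicity. $\{\alpha^p\}\cup U$ denotes the multiset consisting of $p$ copies of $\alpha$ together with the elements of $U$. A $k$-edge-coloring assigns one of $k$ colors to each edge; $\mathcal G_i$ is the sub-hypergraph on $V$ formed by the edges of color $i$, and $d_i(u)$ is the degree of $u$ in $\mathcal G_i$, i.e. the total number of occurrences of $u$ among the edges of color $i$. A hypergraph is connected if any two vertices are joined by a sequence of vertices with consecutive ones lying in a common edge.
   Formalization: Condition (3) is asserted only when h ≥ 2 or ℓ = 1: for h = 1 and ℓ ≥ 2 all edges are single vertices, so no color class can be connected (e.g. n = 2, h = 1, λ = 2, k = 1, r_1 = 2, ℓ = 2); (1) and (2) are proved in all cases. *)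

theory Defs
  imports "HOL-Library.Multiset"
begin

definition hypergraph :: "'a set \<Rightarrow> 'a multiset multiset \<Rightarrow> bool" where
  "hypergraph V E \<longleftrightarrow> finite V \<and> (\<forall>e\<in>#E. set_mset e \<subseteq> V)"

definition uniform_edges :: "nat \<Rightarrow> 'a multiset multiset \<Rightarrow> bool" where
  "uniform_edges h E \<longleftrightarrow> (\<forall>e\<in>#E. size e = h)"

text \<open>Parallel edges may receive different colors, so a coloring cannot be a function of the
  edge as a multiset of vertices.  It is a multiset of pairs (edge, color) whose first components
  make up exactly the edge multiset; the colors are \<open>1, \<dots>, k\<close>.\<close>

definition edge_coloring ::
  "nat \<Rightarrow> 'a multiset multiset \<Rightarrow> ('a multiset \<times> nat) multiset \<Rightarrow> bool" where
  "edge_coloring k E C \<longleftrightarrow> image_mset fst C = E \<and> (\<forall>x\<in>#C. snd x \<in> {1..k})"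

definition color_class :: "('a multiset \<times> nat) multiset \<Rightarrow> nat \<Rightarrow> 'a multiset multiset" where
  "color_class C i = image_mset fst (filter_mset (\<lambda>x. snd x = i) C)"

definition vertex_degree :: "'a multiset multiset \<Rightarrow> 'a \<Rightarrow> nat" where
  "vertex_degree E u = (\<Sum>e\<in>#E. count e u)"

definition hypergraph_connected :: "'a set \<Rightarrow> 'a multiset multiset \<Rightarrow> bool" where
  "hypergraph_connected V E \<longleftrightarrow>
     (\<forall>u\<in>V. \<forall>v\<in>V. (u, v) \<in> {(x, y). x \<in> V \<and> y \<in> V \<and> (\<exists>e\<in>#E. x \<in># e \<and> y \<in># e)}\<^sup>*)"

end

theory Submission
  imports Defs "HOL-Library.Disjoint_Sets" Complex_Main
begin

text \<open>
  New vertices are split off the amalgamated vertex \<open>\<alpha>\<close> one at a time, starting from the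
  hypergraph whose only vertex is \<open>\<alpha>\<close>. If \<open>\<alpha>\<close> currently stands for \<open>m\<close> vertices, the new
  vertex should receive a fraction \<open>1/m\<close> of the occurrences of \<open>\<alpha>\<close> in every color and in every
  class of equal edges, and at most one from each edge. Such a choice is obtained by rounding the
  constant fractional choice along two laminar families of sets of edges: the classes of equal
  edges on one side; colors and blocks of a partition of each color on the other.

  To keep color \<open>i\<close> connected, partition its edges into blocks linked by vertices other than \<open>\<alpha>\<close>,
  each block containing \<open>\<alpha>\<close>. All \<open>m\<close> copies of \<open>\<alpha>\<close> and \<open>t\<close> blocks can be joined into one component
  only if the \<open>r i * m\<close> occurrences of \<open>\<alpha>\<close> number at least \<open>m + t - 1\<close>, and this inequality is
  preserved by the splitting once the union of the blocks in which \<open>\<alpha>\<close> occurs at least twice is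
  added to the second family.
\<close>

section \<open>Rounding along two laminar families\<close>

lemma homogeneous_system_nonzero_solution:
  fixes a :: "'e \<Rightarrow> 'i \<Rightarrow> 'f::field"
  assumes "finite E" "finite I" "card E < card I"
  shows "\<exists>d. (\<exists>i\<in>I. d i \<noteq> 0) \<and> (\<forall>i. i \<notin> I \<longrightarrow> d i = 0) \<and> (\<forall>e\<in>E. (\<Sum>i\<in>I. a e i * d i) = 0)"
  using assms
proof (induction E arbitrary: I rule: finite_induct)
  case empty
  then show ?case by (intro exI[of _ "\<lambda>i. if i \<in> I then 1 else 0"]) (auto simp: card_gt_0_iff)
next
  case (insert e E)
  have "card E < card I" using insert by simp
  then obtain d where d_nz: "\<exists>i\<in>I. d i \<noteq> 0" and d_supp: "\<And>i. i \<notin> I \<Longrightarrow> d i = 0"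
    and d_sol: "\<And>f. f \<in> E \<Longrightarrow> (\<Sum>i\<in>I. a f i * d i) = 0"
    using insert.IH[OF \<open>finite I\<close>] by blast
  \<comment> \<open>A second solution vanishes at some \<open>j\<close> where \<open>d\<close> does not; a nonzero combination of the two
    satisfies the equation \<open>e\<close> as well.\<close>
  obtain j where j: "j \<in> I" "d j \<noteq> 0" using d_nz by blast
  have "card E < card (I - {j})" using insert j by simp
  then obtain d' where d'_nz: "\<exists>i\<in>I - {j}. d' i \<noteq> 0" and d'_supp: "\<And>i. i \<notin> I - {j} \<Longrightarrow> d' i = 0"
    and d'_sol: "\<And>f. f \<in> E \<Longrightarrow> (\<Sum>i\<in>I - {j}. a f i * d' i) = 0"
    using insert.IH[of "I - {j}"] \<open>finite I\<close> by blast
  have extend: "(\<Sum>i\<in>I. a f i * d' i) = (\<Sum>i\<in>I - {j}. a f i * d' i)" for f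
    using \<open>finite I\<close> d'_supp by (intro sum.mono_neutral_right) auto
  define s s' where "s = (\<Sum>i\<in>I. a e i * d i)" and "s' = (\<Sum>i\<in>I. a e i * d' i)"
  show ?case
  proof (cases "s' = 0")
    case True
    then show ?thesis using d'_nz d'_supp d'_sol extend by (intro exI[of _ d']) (auto simp: s'_def)
  next
    case False
    have combination: "(\<Sum>i\<in>I. a f i * (s' * d i - s * d' i))
        = s' * (\<Sum>i\<in>I. a f i * d i) - s * (\<Sum>i\<in>I. a f i * d' i)" for f
      by (simp add: right_diff_distrib sum_subtractf sum_distrib_left mult.left_commute)
    have "(\<Sum>i\<in>I. a f i * (s' * d i - s * d' i)) = 0" if "f \<in> insert e E" for f
      using that d_sol d'_sol extend unfolding combination by (auto simp: s_def s'_def)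
    moreover have "\<exists>i\<in>I. s' * d i - s * d' i \<noteq> 0"
      using False j d'_supp[of j] by (intro bexI[of _ j]) auto
    ultimately show ?thesis using d_supp d'_supp
      by (intro exI[of _ "\<lambda>i. s' * d i - s * d' i"]) auto
  qed
qed

definition laminar :: "'a set set \<Rightarrow> bool" where
  "laminar \<A> \<longleftrightarrow> (\<forall>A\<in>\<A>. \<forall>B\<in>\<A>. A \<subseteq> B \<or> B \<subseteq> A \<or> A \<inter> B = {})"

lemma laminar_subset: "laminar \<B> \<Longrightarrow> \<A> \<subseteq> \<B> \<Longrightarrow> laminar \<A>"
  unfolding laminar_def by blast

lemma laminar_restrict: "laminar \<A> \<Longrightarrow> laminar ((\<inter>) F ` \<A>)"
  unfolding laminar_def by blast

lemma laminar_insert_superset: "laminar \<A> \<Longrightarrow> \<A> \<subseteq> Pow H \<Longrightarrow> laminar (insert H \<A>)"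
  unfolding laminar_def by blast

lemma disjoint_imp_laminar_insert_Union:
  assumes "disjoint P" "Q \<subseteq> P"
  shows "laminar (insert (\<Union>Q) P)"
proof -
  have blocks: "A = B \<or> A \<inter> B = {}" if "A \<in> P" "B \<in> P" for A B
    using assms(1) that by (auto simp: disjoint_def)
  then have "A \<subseteq> \<Union>Q \<or> A \<inter> \<Union>Q = {}" if "A \<in> P" for A
    using that assms(2) by blast
  with blocks show ?thesis unfolding laminar_def by (metis Int_commute insert_iff order.refl)
qed

lemma laminar_UN:
  assumes "\<And>i. i \<in> I \<Longrightarrow> laminar (\<F> i)" "\<And>i. i \<in> I \<Longrightarrow> \<F> i \<subseteq> Pow (K i)" "disjoint_family_on K I"
  shows "laminar (\<Union>i\<in>I. \<F> i)"
  unfolding laminar_def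
proof (intro ballI)
  fix A B assume "A \<in> (\<Union>i\<in>I. \<F> i)" "B \<in> (\<Union>i\<in>I. \<F> i)"
  then obtain i j where ij: "i \<in> I" "A \<in> \<F> i" "j \<in> I" "B \<in> \<F> j" by blast
  then have "A \<subseteq> K i" "B \<subseteq> K j" using assms(2) by blast+
  moreover have "K i \<inter> K j = {}" if "i \<noteq> j"
    using assms(3) ij that by (auto dest: disjoint_family_onD)
  ultimately show "A \<subseteq> B \<or> B \<subseteq> A \<or> A \<inter> B = {}"
    using ij assms(1)[of i] unfolding laminar_def by (cases "i = j") blast+
qed

definition laminar_cell :: "'a set set \<Rightarrow> 'a set \<Rightarrow> 'a set" where
  "laminar_cell \<A> A = A - \<Union>{B \<in> \<A>. B \<subset> A}"

lemma disjoint_family_laminar_cells: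
  assumes "laminar \<A>"
  shows "disjoint_family_on (laminar_cell \<A>) \<A>"
  unfolding disjoint_family_on_def
proof (intro ballI impI)
  fix A B assume AB: "A \<in> \<A>" "B \<in> \<A>" "A \<noteq> B"
  then consider "A \<subset> B" | "B \<subset> A" | "A \<inter> B = {}"
    using assms unfolding laminar_def by (metis psubsetI)
  then show "laminar_cell \<A> A \<inter> laminar_cell \<A> B = {}"
    using AB(1,2) by cases (auto simp: laminar_cell_def)
qed

lemma Union_laminar_cells:
  assumes "finite \<A>" "A \<in> \<A>"
  shows "(\<Union>B\<in>{B \<in> \<A>. B \<subseteq> A}. laminar_cell \<A> B) = A"
proof (intro equalityI subsetI)
  fix h assume "h \<in> A"
  define \<B> where "\<B> = {B \<in> \<A>. B \<subseteq> A \<and> h \<in> B}"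
  have "finite \<B>" "\<B> \<noteq> {}" using assms \<open>h \<in> A\<close> by (auto simp: \<B>_def)
  then obtain B where "B \<in> \<B>" "\<And>C. C \<in> \<B> \<Longrightarrow> C \<subseteq> B \<Longrightarrow> C = B"
    using finite_has_minimal[of \<B>] by metis
  then have "B \<in> \<A>" "B \<subseteq> A" "h \<in> laminar_cell \<A> B"
    by (auto simp: \<B>_def laminar_cell_def)
  then show "h \<in> (\<Union>B\<in>{B \<in> \<A>. B \<subseteq> A}. laminar_cell \<A> B)" by blast
qed (auto simp: laminar_cell_def)

lemma sum_laminar_cells:
  fixes f :: "'a \<Rightarrow> 'b::comm_monoid_add"
  assumes "finite \<A>" "laminar \<A>" "A \<in> \<A>" "finite A"
  shows "sum f A = (\<Sum>B | B \<in> \<A> \<and> B \<subseteq> A. sum f (laminar_cell \<A> B))"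
proof -
  have "sum f (\<Union>B\<in>{B \<in> \<A>. B \<subseteq> A}. laminar_cell \<A> B)
      = (\<Sum>B | B \<in> \<A> \<and> B \<subseteq> A. sum f (laminar_cell \<A> B))"
    using assms disjoint_family_onD[OF disjoint_family_laminar_cells[OF assms(2)]]
    by (intro sum.UNION_disjoint) (auto simp: laminar_cell_def intro: finite_subset)
  then show ?thesis unfolding Union_laminar_cells[OF assms(1,3)] .
qed

lemma sum_laminar_cell_Ints:
  fixes x :: "'a \<Rightarrow> 'b::ring_1"
  assumes "finite \<A>" "laminar \<A>" and integral: "\<And>A. A \<in> \<A> \<Longrightarrow> sum x A \<in> \<int>"
    and "finite A" "A \<in> \<A>"
  shows "sum x (laminar_cell \<A> A) \<in> \<int>"
  using assms(4,5)
proof (induction A rule: finite_psubset_induct)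
  case (psubset A)
  have "{B \<in> \<A>. B \<subseteq> A} = insert A {B \<in> \<A>. B \<subset> A}" using psubset.prems by blast
  then have "sum x A = sum x (laminar_cell \<A> A) + (\<Sum>B | B \<in> \<A> \<and> B \<subset> A. sum x (laminar_cell \<A> B))"
    using sum_laminar_cells[OF assms(1,2) psubset.prems psubset.hyps(1), of x] assms(1) by simp
  then have "sum x (laminar_cell \<A> A) = sum x A - (\<Sum>B | B \<in> \<A> \<and> B \<subset> A. sum x (laminar_cell \<A> B))"
    by (simp add: algebra_simps)
  also have "\<dots> \<in> \<int>" using psubset integral by (intro Ints_diff[OF _ Ints_sum]) auto
  finally show ?case .
qed

definition laminar_partition :: "'a set \<Rightarrow> 'a set set \<Rightarrow> 'a set set" where
  "laminar_partition H \<A> = laminar_cell (insert H \<A>) ` insert H \<A> - {{}}"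

context
  fixes H :: "'a set" and \<A> :: "'a set set"
  assumes finite_H: "finite H" and subset_Pow: "\<A> \<subseteq> Pow H" and laminar: "laminar \<A>"
begin

lemma finite_insert_family: "finite (insert H \<A>)"
  using finite_H subset_Pow by (auto intro: finite_subset[of _ "Pow H"])

lemma finite_family_member: "S \<in> insert H \<A> \<Longrightarrow> finite S"
  using finite_H subset_Pow by (auto intro: finite_subset)

lemma laminar_insert_family: "laminar (insert H \<A>)"
  using laminar subset_Pow by (rule laminar_insert_superset)

lemma partition_on_laminar_partition: "partition_on H (laminar_partition H \<A>)"
proof -
  define cells where "cells = laminar_cell (insert H \<A>) ` insert H \<A>"
  have "{B \<in> insert H \<A>. B \<subseteq> H} = insert H \<A>" using subset_Pow by blast
  then have "\<Union>cells = H"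
    using Union_laminar_cells[OF finite_insert_family, of H] by (simp add: cells_def)
  moreover have "disjoint cells"
    unfolding cells_def using laminar_insert_family
    by (intro disjoint_family_on_disjoint_image disjoint_family_laminar_cells)
  ultimately have "partition_on H (cells - {{}})"
    by (auto simp: partition_on_def disjoint_def)
  then show ?thesis by (simp add: cells_def laminar_partition_def)
qed

lemma sum_laminar_partition_Ints:
  fixes x :: "'a \<Rightarrow> 'b::ring_1"
  assumes "\<And>S. S \<in> insert H \<A> \<Longrightarrow> sum x S \<in> \<int>" "C \<in> laminar_partition H \<A>"
  shows "sum x C \<in> \<int>"
proof -
  obtain S where S: "S \<in> insert H \<A>" "C = laminar_cell (insert H \<A>) S"
    using assms(2) unfolding laminar_partition_def by blast
  then show ?thesis
    using finite_insert_family laminar_insert_family finite_family_member assms(1)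
    by (simp only: sum_laminar_cell_Ints)
qed

lemma sum_eq_0_if_laminar_partition:
  fixes d :: "'a \<Rightarrow> 'b::comm_monoid_add"
  assumes zero: "\<And>C. C \<in> laminar_partition H \<A> \<Longrightarrow> sum d C = 0" and S: "S \<in> \<A>"
  shows "sum d S = 0"
proof -
  have "sum d (laminar_cell (insert H \<A>) B) = 0" if "B \<in> insert H \<A>" for B
  proof (cases "laminar_cell (insert H \<A>) B = {}")
    case False
    then have "laminar_cell (insert H \<A>) B \<in> laminar_partition H \<A>"
      using that unfolding laminar_partition_def by blast
    then show ?thesis by (rule zero)
  qed simp
  then show ?thesis
    using sum_laminar_cells[OF finite_insert_family laminar_insert_family, of S d]
      finite_family_member[of S] S by simp
qed

end

lemma sum_partition_on:
  assumes "finite A" "partition_on A P"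
  shows "sum f A = (\<Sum>B\<in>P. sum f B)"
proof -
  have "sum f (\<Union>P) = (\<Sum>B\<in>P. sum f B)"
    using assms sum.Union_disjoint[of P f]
    by (auto simp: partition_on_def disjoint_def intro: finite_subset)
  then show ?thesis using assms by (simp add: partition_on_def)
qed

lemma card_partition_on_le_half:
  fixes x :: "'a \<Rightarrow> 'b::ring_1"
  assumes "finite F" "partition_on F P" and nonintegral: "\<And>h. h \<in> F \<Longrightarrow> x h \<notin> \<int>"
    and integral: "\<And>B. B \<in> P \<Longrightarrow> sum x B \<in> \<int>"
  shows "2 * card P \<le> card F"
proof -
  have two: "2 \<le> card B" if "B \<in> P" for B
  proof -
    have "finite B" "B \<noteq> {}" "B \<subseteq> F"
      using assms that by (auto simp: partition_on_def intro: finite_subset)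
    moreover have "B \<noteq> {h}" for h
      using integral[OF that] nonintegral \<open>B \<subseteq> F\<close> by auto
    ultimately have "card B \<noteq> 0" "card B \<noteq> 1" by (auto simp: card_1_singleton_iff)
    then show ?thesis by simp
  qed
  have "2 * card P \<le> (\<Sum>B\<in>P. card B)" using sum_mono[OF two, of P "\<lambda>B. B"] by simp
  also have "\<dots> = card F" using sum_partition_on[OF assms(1,2), of "\<lambda>_. 1::nat"] by simp
  finally show ?thesis .
qed

lemma partitions_zero_sum_weighting:
  assumes "finite F" "F \<noteq> {}" "partition_on F P" "partition_on F Q"
    and "2 * card P \<le> card F" "2 * card Q \<le> card F"
  shows "\<exists>d :: 'a \<Rightarrow> 'f::field. (\<exists>h\<in>F. d h \<noteq> 0) \<and> (\<forall>h. h \<notin> F \<longrightarrow> d h = 0) \<and> (\<forall>B\<in>P \<union> Q. sum d B = 0)"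
proof -
  have fin: "finite P" "finite Q" using assms by (auto intro: finite_elements)
  obtain B\<^sub>0 where B\<^sub>0: "B\<^sub>0 \<in> Q" using assms(2,4) by (auto simp: partition_on_def)
  \<comment> \<open>Both systems of equations add up to the same total, so one equation can be dropped.\<close>
  define \<E> where "\<E> = P \<union> (Q - {B\<^sub>0})"
  have "card \<E> \<le> card P + card (Q - {B\<^sub>0})" unfolding \<E>_def by (rule card_Un_le)
  also have "\<dots> < card P + card Q"
    using fin B\<^sub>0 by (intro add_strict_left_mono psubset_card_mono) auto
  also have "\<dots> \<le> card F" using assms(5,6) by simp
  finally have "card \<E> < card F" .
  then obtain d :: "'a \<Rightarrow> 'f" where d: "\<exists>h\<in>F. d h \<noteq> 0" "\<And>h. h \<notin> F \<Longrightarrow> d h = 0"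
    and solution: "\<And>B. B \<in> \<E> \<Longrightarrow> (\<Sum>h\<in>F. of_bool (h \<in> B) * d h) = 0"
    using homogeneous_system_nonzero_solution[of \<E> F "\<lambda>B h. of_bool (h \<in> B)"] fin \<open>finite F\<close>
    by (auto simp: \<E>_def)
  have block: "sum d B = 0" if "B \<in> \<E>" for B
  proof -
    have "B \<subseteq> F" using that assms(3,4) by (auto simp: \<E>_def partition_on_def)
    then have "sum d B = (\<Sum>h\<in>F. of_bool (h \<in> B) * d h)"
      using \<open>finite F\<close> by (simp add: Int_absorb1)
    then show ?thesis using solution[OF that] by simp
  qed
  have "(\<Sum>B\<in>Q. sum d B) = (\<Sum>B\<in>P. sum d B)"
    using assms(1,3,4) by (simp flip: sum_partition_on)
  also have "\<dots> = 0" using block by (simp add: \<E>_def)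
  finally have "sum d B\<^sub>0 = 0"
    using block fin B\<^sub>0 by (simp add: \<E>_def sum.remove)
  then have "\<forall>B\<in>P \<union> Q. sum d B = 0" using block by (auto simp: \<E>_def)
  then show ?thesis using d by blast
qed

lemma laminar_zero_sum_weighting:
  fixes x :: "'a \<Rightarrow> 'f::field"
  assumes F: "finite F" "F \<noteq> {}" and A: "\<A> \<subseteq> Pow F" "laminar \<A>" and B: "\<B> \<subseteq> Pow F" "laminar \<B>"
    and nonintegral: "\<And>h. h \<in> F \<Longrightarrow> x h \<notin> \<int>"
    and integral: "\<And>S. S \<in> insert F (\<A> \<union> \<B>) \<Longrightarrow> sum x S \<in> \<int>"
  shows "\<exists>d :: 'a \<Rightarrow> 'f. (\<exists>h\<in>F. d h \<noteq> 0) \<and> (\<forall>h. h \<notin> F \<longrightarrow> d h = 0) \<and> (\<forall>S\<in>\<A> \<union> \<B>. sum d S = 0)"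
proof -
  have cells: "partition_on F (laminar_partition F \<C>)" "2 * card (laminar_partition F \<C>) \<le> card F"
    if C: "\<C> \<subseteq> Pow F" "laminar \<C>" "\<C> \<subseteq> \<A> \<union> \<B>" for \<C>
  proof -
    show part: "partition_on F (laminar_partition F \<C>)"
      using F(1) C(1,2) by (rule partition_on_laminar_partition)
    have "sum x S \<in> \<int>" if "S \<in> insert F \<C>" for S using that integral C(3) by blast
    then have "sum x A \<in> \<int>" if "A \<in> laminar_partition F \<C>" for A
      using sum_laminar_partition_Ints[OF F(1) C(1,2)] that by blast
    then show "2 * card (laminar_partition F \<C>) \<le> card F"
      using F(1) part nonintegral by (intro card_partition_on_le_half)
  qed
  obtain d :: "'a \<Rightarrow> 'f" where d: "\<exists>h\<in>F. d h \<noteq> 0" "\<And>h. h \<notin> F \<Longrightarrow> d h = 0"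
    and zero: "\<And>C. C \<in> laminar_partition F \<A> \<union> laminar_partition F \<B> \<Longrightarrow> sum d C = 0"
    using partitions_zero_sum_weighting[OF F cells(1)[OF A Un_upper1] cells(1)[OF B Un_upper2]
      cells(2)[OF A Un_upper1] cells(2)[OF B Un_upper2]] by blast
  have "sum d S = 0" if "S \<in> \<A>" for S
    using sum_eq_0_if_laminar_partition[OF F(1) A, of d] zero that by blast
  moreover have "sum d S = 0" if "S \<in> \<B>" for S
    using sum_eq_0_if_laminar_partition[OF F(1) B, of d] zero that by blast
  ultimately show ?thesis using d by blast
qed

lemma laminar_fractional_direction:
  fixes x :: "'a \<Rightarrow> 'f::field"
  assumes "finite H" and A: "\<A> \<subseteq> Pow H" "laminar \<A>" and B: "\<B> \<subseteq> Pow H" "laminar \<B>"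
    and "sum x H \<in> \<int>" and "\<exists>h\<in>H. x h \<notin> \<int>"
  shows "\<exists>d :: 'a \<Rightarrow> 'f. (\<exists>h\<in>H. d h \<noteq> 0) \<and> (\<forall>h\<in>H. x h \<in> \<int> \<longrightarrow> d h = 0) \<and>
    (\<forall>S\<in>\<A> \<union> \<B>. sum x S \<in> \<int> \<longrightarrow> sum d S = 0)"
proof -
  define F where "F = {h \<in> H. x h \<notin> \<int>}"
  define tight where "tight \<C> = (\<inter>) F ` {S \<in> \<C>. sum x S \<in> \<int>}" for \<C>
  have fractional_part: "sum x (F \<inter> S) \<in> \<int>" if "S \<subseteq> H" "sum x S \<in> \<int>" for S
  proof -
    have "finite S" using that \<open>finite H\<close> by (auto intro: finite_subset)
    then have "sum x (F \<inter> S) = sum x S - sum x (S - F)"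
      by (simp add: sum.Int_Diff[of S x F] Int_commute)
    also have "\<dots> \<in> \<int>"
      using that by (intro Ints_diff[OF _ Ints_sum]) (auto simp: F_def)
    finally show ?thesis .
  qed
  have F: "finite F" "F \<noteq> {}" "F \<inter> H = F" using assms by (auto simp: F_def)
  have tight: "tight \<C> \<subseteq> Pow F" "laminar (tight \<C>)" if "laminar \<C>" for \<C>
    using that by (auto simp: tight_def intro!: laminar_restrict intro: laminar_subset)
  have nonintegral: "x h \<notin> \<int>" if "h \<in> F" for h
    using that by (simp add: F_def)
  have integral: "sum x S \<in> \<int>" if "S \<in> insert F (tight \<A> \<union> tight \<B>)" for S
    using that fractional_part fractional_part[of H] A B \<open>sum x H \<in> \<int>\<close> F(3)
    by (auto simp: tight_def)
  obtain d :: "'a \<Rightarrow> 'f" where d: "\<exists>h\<in>F. d h \<noteq> 0" "\<And>h. h \<notin> F \<Longrightarrow> d h = 0"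
    and zero: "\<And>S. S \<in> tight \<A> \<union> tight \<B> \<Longrightarrow> sum d S = 0"
    using laminar_zero_sum_weighting[OF F(1,2) tight[OF A(2)] tight[OF B(2)] nonintegral integral]
    by blast
  have "sum d S = 0" if "S \<in> \<A> \<union> \<B>" "sum x S \<in> \<int>" for S
  proof -
    have "finite S" using that A B \<open>finite H\<close> by (auto intro: finite_subset)
    then have "sum d S = sum d (F \<inter> S)"
      using d(2) by (intro sum.mono_neutral_right) auto
    then show ?thesis using that zero by (auto simp: tight_def)
  qed
  then show ?thesis using d by (intro exI[of _ d]) (auto simp: F_def)
qed

lemma first_integer_along_line:
  fixes x d :: real
  assumes "d \<noteq> 0"
  obtains w where "0 \<le> w" "x + w * d \<in> \<int>"
    "\<And>t. 0 \<le> t \<Longrightarrow> t \<le> w \<Longrightarrow> x + t * d \<in> {\<lfloor>x\<rfloor>..\<lceil>x\<rceil>}"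
proof (cases "d > 0")
  case True
  show ?thesis
  proof (rule that[of "(\<lceil>x\<rceil> - x) / d"])
    fix t assume t: "0 \<le> t" "t \<le> (\<lceil>x\<rceil> - x) / d"
    then have "0 \<le> t * d" "t * d \<le> \<lceil>x\<rceil> - x" using True by (simp_all add: pos_le_divide_eq)
    then have "\<lfloor>x\<rfloor> \<le> x + t * d" "x + t * d \<le> \<lceil>x\<rceil>" by linarith+
    then show "x + t * d \<in> {\<lfloor>x\<rfloor>..\<lceil>x\<rceil>}" by simp
  qed (use True in auto)
next
  case False
  then have "d < 0" using assms by simp
  show ?thesis
  proof (rule that[of "(\<lfloor>x\<rfloor> - x) / d"])
    fix t assume t: "0 \<le> t" "t \<le> (\<lfloor>x\<rfloor> - x) / d"
    then have "t * d \<le> 0" "\<lfloor>x\<rfloor> - x \<le> t * d"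
      using \<open>d < 0\<close> by (simp_all add: neg_le_divide_eq mult_nonneg_nonpos)
    then have "\<lfloor>x\<rfloor> \<le> x + t * d" "x + t * d \<le> \<lceil>x\<rceil>" by linarith+
    then show "x + t * d \<in> {\<lfloor>x\<rfloor>..\<lceil>x\<rceil>}" by simp
  qed (use \<open>d < 0\<close> in \<open>auto simp: divide_nonpos_neg\<close>)
qed

lemma first_integer_along_lines:
  fixes x d :: "'s \<Rightarrow> real"
  assumes "finite S" "\<exists>s\<in>S. d s \<noteq> 0"
  obtains t where "\<And>s. s \<in> S \<Longrightarrow> x s + t * d s \<in> {\<lfloor>x s\<rfloor>..\<lceil>x s\<rceil>}"
    "\<exists>s\<in>S. d s \<noteq> 0 \<and> x s + t * d s \<in> \<int>"
proof -
  define D where "D = {s \<in> S. d s \<noteq> 0}"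
  have D: "finite D" "D \<noteq> {}" using assms by (auto simp: D_def)
  have "\<forall>s\<in>D. \<exists>w\<ge>0. x s + w * d s \<in> \<int> \<and>
      (\<forall>t. 0 \<le> t \<longrightarrow> t \<le> w \<longrightarrow> x s + t * d s \<in> {\<lfloor>x s\<rfloor>..\<lceil>x s\<rceil>})"
    using first_integer_along_line by (simp add: D_def) metis
  then obtain w where w: "\<And>s. s \<in> D \<Longrightarrow> 0 \<le> w s" "\<And>s. s \<in> D \<Longrightarrow> x s + w s * d s \<in> \<int>"
    "\<And>s t. s \<in> D \<Longrightarrow> 0 \<le> t \<Longrightarrow> t \<le> w s \<Longrightarrow> x s + t * d s \<in> {\<lfloor>x s\<rfloor>..\<lceil>x s\<rceil>}"
    by metis
  obtain s where s: "s \<in> D" "\<And>s'. s' \<in> D \<Longrightarrow> w s \<le> w s'"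
    using arg_min_if_finite[OF D, of w] by (metis linorder_not_less)
  have "x s' + w s * d s' \<in> {\<lfloor>x s'\<rfloor>..\<lceil>x s'\<rceil>}" if "s' \<in> S" for s'
    using that w(1)[OF s(1)] s(2) w(3)[of s' "w s"] by (cases "d s' = 0") (auto simp: D_def)
  then show ?thesis using s(1) w(2) by (intro that[of "w s"]) (auto simp: D_def)
qed

definition rounds :: "'a set set \<Rightarrow> ('a \<Rightarrow> real) \<Rightarrow> ('a \<Rightarrow> real) \<Rightarrow> bool" where
  "rounds \<S> x y \<longleftrightarrow> (\<forall>S\<in>\<S>. sum y S \<in> {real_of_int \<lfloor>sum x S\<rfloor>..real_of_int \<lceil>sum x S\<rceil>})"

lemma roundsD:
  fixes x y :: "'a \<Rightarrow> real"
  assumes "rounds \<S> x y" "S \<in> \<S>"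
  shows "\<lfloor>sum x S\<rfloor> \<le> sum y S" "sum y S \<le> \<lceil>sum x S\<rceil>"
  using assms by (auto simp: rounds_def)

lemma rounds_refl: "rounds \<S> x x"
  by (simp add: rounds_def)

lemma rounds_trans:
  fixes x y z :: "'a \<Rightarrow> real"
  assumes "rounds \<S> x y" "rounds \<S> y z"
  shows "rounds \<S> x z"
  unfolding rounds_def
proof
  fix S assume "S \<in> \<S>"
  note y = roundsD[OF assms(1) this] and z = roundsD[OF assms(2) this]
  have "\<lfloor>sum x S\<rfloor> \<le> \<lfloor>sum y S\<rfloor>" "\<lceil>sum y S\<rceil> \<le> \<lceil>sum x S\<rceil>"
    using y by (simp_all add: le_floor_iff ceiling_le_iff)
  then have "\<lfloor>sum x S\<rfloor> \<le> sum z S" "sum z S \<le> \<lceil>sum x S\<rceil>" using z by linarith+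
  then show "sum z S \<in> {real_of_int \<lfloor>sum x S\<rfloor>..real_of_int \<lceil>sum x S\<rceil>}" by simp
qed

lemma rounds_eq:
  assumes "rounds \<S> x y" "S \<in> \<S>" "sum x S \<in> \<int>"
  shows "sum y S = sum x S"
  using assms by (auto simp: rounds_def elim!: Ints_cases)

lemma laminar_rounding_step:
  fixes x :: "'a \<Rightarrow> real"
  assumes H: "finite H" and A: "\<A> \<subseteq> Pow H" "laminar \<A>" and B: "\<B> \<subseteq> Pow H" "laminar \<B>"
    and "sum x H \<in> \<int>" and "\<exists>h\<in>H. x h \<notin> \<int>"
    and S: "\<S> = insert H (\<A> \<union> \<B> \<union> (\<lambda>h. {h}) ` H)"
  obtains y where "rounds \<S> x y" "{S \<in> \<S>. sum y S \<notin> \<int>} \<subset> {S \<in> \<S>. sum x S \<notin> \<int>}"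
proof -
  have HA: "insert H \<A> \<subseteq> Pow H" "laminar (insert H \<A>)"
    using A by (auto intro: laminar_insert_superset)
  obtain d :: "'a \<Rightarrow> real" where d: "\<exists>h\<in>H. d h \<noteq> 0" "\<And>h. h \<in> H \<Longrightarrow> x h \<in> \<int> \<Longrightarrow> d h = 0"
    "\<And>S. S \<in> insert H \<A> \<union> \<B> \<Longrightarrow> sum x S \<in> \<int> \<Longrightarrow> sum d S = 0"
    using laminar_fractional_direction[OF H HA B assms(6,7)] by blast
  have zero: "sum d S = 0" if "S \<in> \<S>" "sum x S \<in> \<int>" for S
    using that d(2,3) unfolding S by auto
  have "finite \<S>" using A B H unfolding S by (auto intro: finite_subset[of _ "Pow H"])
  moreover have "\<exists>S\<in>\<S>. sum d S \<noteq> 0" using d(1) by (force simp: S)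
  ultimately obtain t where
    t: "\<And>S. S \<in> \<S> \<Longrightarrow> sum x S + t * sum d S \<in> {\<lfloor>sum x S\<rfloor>..\<lceil>sum x S\<rceil>}"
      "\<exists>S\<in>\<S>. sum d S \<noteq> 0 \<and> sum x S + t * sum d S \<in> \<int>"
    using first_integer_along_lines[of \<S> "sum d" "sum x"] by blast
  define y where "y h = x h + t * d h" for h
  have sum_y: "sum y S = sum x S + t * sum d S" for S
    by (simp add: y_def sum.distrib sum_distrib_left)
  have round: "rounds \<S> x y" using t(1) by (simp add: rounds_def sum_y)
  then have "{S \<in> \<S>. sum y S \<notin> \<int>} \<subseteq> {S \<in> \<S>. sum x S \<notin> \<int>}" by (auto dest: rounds_eq)
  moreover have "\<exists>S\<in>\<S>. sum x S \<notin> \<int> \<and> sum y S \<in> \<int>" using t(2) zero by (auto simp: sum_y)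
  ultimately show ?thesis using round by (intro that[of y]) blast+
qed

theorem laminar_rounding:
  fixes x :: "'a \<Rightarrow> real"
  assumes H: "finite H" and A: "\<A> \<subseteq> Pow H" "laminar \<A>" and B: "\<B> \<subseteq> Pow H" "laminar \<B>"
    and "sum x H \<in> \<int>"
  obtains y where "\<And>h. h \<in> H \<Longrightarrow> y h \<in> \<int>" "rounds (\<A> \<union> \<B> \<union> (\<lambda>h. {h}) ` H) x y"
proof -
  define \<S> where "\<S> = insert H (\<A> \<union> \<B> \<union> (\<lambda>h. {h}) ` H)"
  have "finite \<S>" using A B H unfolding \<S>_def by (auto intro: finite_subset[of _ "Pow H"])
  have "\<exists>y. (\<forall>h\<in>H. y h \<in> \<int>) \<and> rounds \<S> x y"
    using \<open>sum x H \<in> \<int>\<close>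
  proof (induction "card {S \<in> \<S>. sum x S \<notin> \<int>}" arbitrary: x rule: less_induct)
    case less
    show ?case
    proof (cases "\<forall>h\<in>H. x h \<in> \<int>")
      case True
      then show ?thesis using rounds_refl by blast
    next
      case False
      then obtain z where z: "rounds \<S> x z" "{S \<in> \<S>. sum z S \<notin> \<int>} \<subset> {S \<in> \<S>. sum x S \<notin> \<int>}"
        using laminar_rounding_step[OF H A B less.prems _ \<S>_def] by blast
      then have "card {S \<in> \<S>. sum z S \<notin> \<int>} < card {S \<in> \<S>. sum x S \<notin> \<int>}"
        using \<open>finite \<S>\<close> by (intro psubset_card_mono) auto
      moreover have "sum z H \<in> \<int>"
        using rounds_eq[OF z(1) _ less.prems] less.prems by (simp add: \<S>_def)
      ultimately obtain y where "\<forall>h\<in>H. y h \<in> \<int>" "rounds \<S> z y"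
        using less.hyps by blast
      then show ?thesis using rounds_trans[OF z(1)] by blast
    qed
  qed
  then obtain y where "\<forall>h\<in>H. y h \<in> \<int>" "rounds \<S> x y" by blast
  then show ?thesis by (intro that[of y]) (auto simp: \<S>_def rounds_def)
qed

text \<open>In terms of real numbers, \<open>card (X \<inter> S)\<close> differs from \<open>sum p S / m\<close> by less than one.\<close>

definition fair_sample :: "'a set set \<Rightarrow> ('a \<Rightarrow> nat) \<Rightarrow> nat \<Rightarrow> 'a set \<Rightarrow> bool" where
  "fair_sample \<S> p m X \<longleftrightarrow>
     (\<forall>S\<in>\<S>. sum p S < card (X \<inter> S) * m + m \<and> card (X \<inter> S) * m < sum p S + m)"

lemma fair_sample_exact:
  assumes "fair_sample \<S> p m X" "S \<in> \<S>" "m dvd sum p S"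
  shows "card (X \<inter> S) * m = sum p S"
proof -
  obtain q where q: "sum p S = q * m" using assms(3) by (metis dvdE mult.commute)
  then have "q * m < Suc (card (X \<inter> S)) * m" "card (X \<inter> S) * m < Suc q * m"
    using assms by (auto simp: fair_sample_def)
  then have "q < Suc (card (X \<inter> S))" "card (X \<inter> S) < Suc q" by (metis mult_less_cancel2)+
  then show ?thesis using q by simp
qed

lemma fair_sample_meets:
  assumes "fair_sample \<S> p m X" "S \<in> \<S>" "m \<le> sum p S"
  shows "X \<inter> S \<noteq> {}"
proof
  assume "X \<inter> S = {}"
  then show False using assms by (auto simp: fair_sample_def)
qed

lemma Ints_rounding_unit_interval:
  fixes x y :: real
  assumes "y \<in> \<int>" "\<lfloor>x\<rfloor> \<le> y" "y \<le> \<lceil>x\<rceil>" "0 \<le> x" "x \<le> 1"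
  shows "y = 0 \<or> y = 1"
proof -
  have "0 \<le> \<lfloor>x\<rfloor>" "\<lceil>x\<rceil> \<le> 1" using assms(4,5) by (simp_all add: ceiling_le_iff)
  then have "0 \<le> y" "y \<le> 1" using assms(2,3) by linarith+
  moreover obtain z where "y = of_int z" using assms(1) by (rule Ints_cases)
  ultimately show ?thesis by auto
qed

lemma nat_quotient_rounding_bounds:
  fixes s k m :: nat
  assumes "\<lfloor>real s / real m\<rfloor> \<le> real k" "real k \<le> \<lceil>real s / real m\<rceil>" "0 < m"
  shows "s < k * m + m" "k * m < s + m"
proof -
  have "real s / real m < real k + 1" "real k < real s / real m + 1" using assms(1,2) by linarith+
  then have "real s < real (k * m + m)" "real (k * m) < real (s + m)"
    using assms(3) by (simp_all add: field_simps)
  then show "s < k * m + m" "k * m < s + m" by (simp_all only: of_nat_less_iff)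
qed

lemma laminar_fair_sample:
  fixes p :: "'a \<Rightarrow> nat"
  assumes H: "finite H" and A: "\<A> \<subseteq> Pow H" "laminar \<A>" and B: "\<B> \<subseteq> Pow H" "laminar \<B>"
    and m: "0 < m" "m dvd sum p H" and bound: "\<And>j. j \<in> H \<Longrightarrow> p j \<le> m"
  obtains X where "X \<subseteq> H" "\<And>j. j \<in> X \<Longrightarrow> 0 < p j" "fair_sample (\<A> \<union> \<B>) p m X"
proof -
  define x where "x j = real (p j) / real m" for j
  have sum_x: "sum x S = real (sum p S) / real m" for S
    by (simp add: x_def sum_divide_distrib)
  obtain q where "sum p H = m * q" using m(2) by (rule dvdE)
  then have "sum x H = of_nat q" using m(1) unfolding sum_x by simp
  then have "sum x H \<in> \<int>" by simp
  then obtain y where y_Ints: "\<And>j. j \<in> H \<Longrightarrow> y j \<in> \<int>"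
    and y: "rounds (\<A> \<union> \<B> \<union> (\<lambda>j. {j}) ` H) x y"
    using laminar_rounding[OF H A B] by blast
  define X where "X = {j \<in> H. y j = 1}"
  have y_bounds: "\<lfloor>x j\<rfloor> \<le> y j" "y j \<le> \<lceil>x j\<rceil>" if "j \<in> H" for j
    using that roundsD[OF y, of "{j}"] by auto
  have y_X: "y j = of_bool (j \<in> X)" if "j \<in> H" for j
    using Ints_rounding_unit_interval[OF y_Ints y_bounds, of j] that bound[OF that] m
    by (auto simp: X_def x_def)
  have "0 < p j" if "j \<in> X" for j
    using that y_bounds[of j] by (cases "p j = 0") (auto simp: X_def x_def)
  moreover have "fair_sample (\<A> \<union> \<B>) p m X"
    unfolding fair_sample_def
  proof
    fix S assume S: "S \<in> \<A> \<union> \<B>"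
    then have "S \<subseteq> H" "finite S" using A B H by (auto intro: finite_subset)
    then have "sum y S = (\<Sum>j\<in>S. of_bool (j \<in> X))" using y_X by (intro sum.cong) auto
    then have "sum y S = real (card (X \<inter> S))" using \<open>finite S\<close> by (simp add: Int_commute)
    then have "\<lfloor>sum x S\<rfloor> \<le> real (card (X \<inter> S))" "real (card (X \<inter> S)) \<le> \<lceil>sum x S\<rceil>"
      using roundsD[OF y, of S] S by auto
    then show "sum p S < card (X \<inter> S) * m + m \<and> card (X \<inter> S) * m < sum p S + m"
      using nat_quotient_rounding_bounds[OF _ _ m(1), of "sum p S" "card (X \<inter> S)"]
      unfolding sum_x by blast
  qed
  ultimately show ?thesis by (intro that[of X]) (auto simp: X_def)
qed

section \<open>Merging the blocks of a weighted partition\<close>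

lemma partition_on_merge:
  assumes "partition_on J P" "Q \<subseteq> P" "Q \<noteq> {}"
  shows "partition_on J (insert (\<Union>Q) (P - Q))"
proof -
  have blocks: "A = B \<or> A \<inter> B = {}" if "A \<in> P" "B \<in> P" for A B
    using assms(1) that by (auto simp: disjoint_def partition_on_def)
  have "disjoint (insert (\<Union>Q) (P - Q))"
    unfolding disjoint_def using blocks assms(2) by blast
  moreover have "\<Union>(insert (\<Union>Q) (P - Q)) = J" using assms by (auto simp: partition_on_def)
  moreover have "\<Union>Q \<noteq> {}"
    using assms unfolding partition_on_def by (metis Union_empty_conv equals0I subsetD)
  ultimately show ?thesis using assms(1) by (auto simp: partition_on_def)
qed

definition merge_meeting :: "'a set \<Rightarrow> 'a set set \<Rightarrow> 'a set set" where
  "merge_meeting X P = insert (\<Union>{W \<in> P. X \<inter> W \<noteq> {}}) {W \<in> P. X \<inter> W = {}}"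

lemma partition_on_merge_meeting:
  assumes "partition_on K P" "X \<inter> K \<noteq> {}"
  shows "partition_on K (merge_meeting X P)"
proof -
  have "merge_meeting X P = insert (\<Union>{W \<in> P. X \<inter> W \<noteq> {}}) (P - {W \<in> P. X \<inter> W \<noteq> {}})"
    by (auto simp: merge_meeting_def)
  moreover have "{W \<in> P. X \<inter> W \<noteq> {}} \<noteq> {}" using assms by (auto simp: partition_on_def)
  ultimately show ?thesis using assms(1) by (simp add: partition_on_merge)
qed

lemma sum_merge_meeting:
  assumes "finite P" "X \<inter> \<Union>P \<noteq> {}"
  shows "(\<Sum>W\<in>merge_meeting X P. f W) = f (\<Union>{W \<in> P. X \<inter> W \<noteq> {}}) + (\<Sum>W | W \<in> P \<and> X \<inter> W = {}. f W)"
proof -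
  have "X \<inter> \<Union>{W \<in> P. X \<inter> W \<noteq> {}} \<noteq> {}" using assms(2) by blast
  then have "\<Union>{W \<in> P. X \<inter> W \<noteq> {}} \<notin> {W \<in> P. X \<inter> W = {}}" by blast
  then show ?thesis using assms(1) by (simp add: merge_meeting_def)
qed

text \<open>Think of \<open>p j\<close> as the number of occurrences of \<open>\<alpha>\<close> in the edge \<open>j\<close>, and of \<open>m\<close> as the
  number of vertices amalgamated in \<open>\<alpha>\<close>. Each occurrence attaches a block to one of the \<open>m\<close>
  vertices, and a connected bipartite graph on \<open>card P + m\<close> vertices has at least
  \<open>card P + m - 1\<close> edges.\<close>

definition joinable :: "('j \<Rightarrow> nat) \<Rightarrow> 'j set \<Rightarrow> nat \<Rightarrow> 'j set set \<Rightarrow> bool" where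
  "joinable p K m P \<longleftrightarrow> partition_on K P \<and> (\<forall>W\<in>P. 1 \<le> sum p W) \<and> card P + m \<le> sum p K + 1"

definition heavy_part :: "('j \<Rightarrow> nat) \<Rightarrow> 'j set set \<Rightarrow> 'j set" where
  "heavy_part p P = \<Union>{W \<in> P. 2 \<le> sum p W}"

lemma heavy_part_weight:
  assumes K: "finite K" and P: "joinable p K m P" and m: "2 \<le> m"
  shows "m \<le> sum p (heavy_part p P)"
proof -
  define L where "L = {W \<in> P. 2 \<le> sum p W}"
  have part: "partition_on K P" and pos: "\<And>W. W \<in> P \<Longrightarrow> 1 \<le> sum p W"
    and count: "card P + m \<le> sum p K + 1"
    using P by (auto simp: joinable_def)
  have finite: "finite P" "finite L" "L \<subseteq> P"
    using finite_elements[OF K part] by (auto simp: L_def)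
  have "partition_on (\<Union>L) L" "\<Union>L \<subseteq> K"
    using part by (auto simp: L_def partition_on_def disjoint_def)
  then have heavy: "sum p (\<Union>L) = (\<Sum>W\<in>L. sum p W)"
    using K by (intro sum_partition_on) (auto intro: finite_subset)
  have light: "(\<Sum>W\<in>P - L. sum p W) = card (P - L)"
    using pos by (subst card_eq_sum, intro sum.cong) (force simp: L_def)+
  have "sum p K = (\<Sum>W\<in>P. sum p W)" using K part by (rule sum_partition_on)
  also have "\<dots> = sum p (\<Union>L) + card (P - L)"
    using finite light heavy by (simp add: sum.subset_diff[of L P])
  finally have "sum p K = sum p (\<Union>L) + card (P - L)" .
  moreover have "card P = card L + card (P - L)"
    using finite by (simp add: card_Diff_subset card_mono)
  ultimately have excess: "card L + m \<le> sum p (\<Union>L) + 1" using count by simp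
  then have "L \<noteq> {}" using m by auto
  then have "1 \<le> card L" using finite by (simp add: Suc_le_eq card_gt_0_iff)
  then show ?thesis using excess by (simp add: L_def heavy_part_def)
qed

lemma less_of_mult_less_add:
  fixes c s m :: nat
  assumes "c * m < s + m" "2 \<le> s" "2 \<le> m"
  shows "c < s"
proof (rule ccontr)
  assume "\<not> c < s"
  then have "s * m < s + m" using assms(1) mult_le_mono1[of s c m] by linarith
  moreover obtain a b where "s = Suc (Suc a)" "m = Suc (Suc b)"
    using assms(2,3) by (metis Suc_le_D numeral_2_eq_2 Suc_le_mono)
  ultimately show False by simp
qed

text \<open>Splitting a vertex off \<open>\<alpha>\<close> takes one occurrence of \<open>\<alpha>\<close> away from each edge in \<open>X\<close>.\<close>

locale weight_decrement =
  fixes K :: "'j set" and X :: "'j set" and p q :: "'j \<Rightarrow> nat" and m :: nat and P :: "'j set set"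
  assumes finite_K: "finite K" and joinable: "joinable p K m P" and m: "2 \<le> m"
    and decrement: "\<And>j. j \<in> K \<Longrightarrow> q j + of_bool (j \<in> X) = p j"
    and fair: "\<And>W. W \<in> P \<Longrightarrow> card (X \<inter> W) * m < sum p W + m"
    and heavy: "X \<inter> heavy_part p P \<noteq> {}"
begin

abbreviation (input) merged :: "'j set" where "merged \<equiv> \<Union>{W \<in> P. X \<inter> W \<noteq> {}}"

abbreviation (input) untouched :: "'j set set" where "untouched \<equiv> {W \<in> P. X \<inter> W = {}}"

lemma partition: "partition_on K P"
  using joinable by (simp add: joinable_def)

lemma finite_P: "finite P"
  using finite_K partition by (rule finite_elements)

lemma block_subset: "W \<in> P \<Longrightarrow> W \<subseteq> K"
  using partition by (auto simp: partition_on_def)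

lemma X_meets: "X \<inter> \<Union>P \<noteq> {}"
  using heavy by (auto simp: heavy_part_def)

lemma sum_decrement:
  assumes "W \<subseteq> K"
  shows "sum q W + card (X \<inter> W) = sum p W"
proof -
  have "finite W" using assms finite_K by (rule finite_subset)
  then have "sum q W + card (X \<inter> W) = (\<Sum>j\<in>W. q j + of_bool (j \<in> X))"
    by (simp add: sum.distrib Int_commute)
  also have "\<dots> = sum p W" using assms by (intro sum.cong decrement) auto
  finally show ?thesis .
qed

lemma block_le_merged:
  assumes "W \<in> P" "X \<inter> W \<noteq> {}"
  shows "sum q W \<le> sum q merged"
proof (rule sum_mono2)
  have "merged \<subseteq> K" using block_subset by blast
  then show "finite merged" using finite_K by (rule finite_subset)
qed (use assms in auto)

lemma merged_pos: "1 \<le> sum q merged"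
proof -
  obtain W where W: "W \<in> P" "2 \<le> sum p W" "X \<inter> W \<noteq> {}"
    using heavy by (auto simp: heavy_part_def)
  have "card (X \<inter> W) < sum p W" using fair[OF W(1)] W(2) m by (rule less_of_mult_less_add)
  then have "1 \<le> sum q W" using sum_decrement[OF block_subset[OF W(1)]] by simp
  then show ?thesis using block_le_merged[OF W(1,3)] by simp
qed

lemma untouched_pos: "W \<in> untouched \<Longrightarrow> 1 \<le> sum q W"
  using joinable sum_decrement[OF block_subset, of W] by (auto simp: joinable_def)

lemma card_merge_meeting: "card (merge_meeting X P) = Suc (card untouched)"
  using sum_merge_meeting[OF finite_P X_meets, of "\<lambda>_. 1::nat"] by simp

lemma partition_merge_meeting: "partition_on K (merge_meeting X P)"
  using partition X_meets by (intro partition_on_merge_meeting) (auto simp: partition_on_def)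

lemma merged_heavy:
  assumes W: "W \<in> P" "2 \<le> card (X \<inter> W)"
  shows "m - 1 \<le> sum q merged"
proof -
  obtain a b where "card (X \<inter> W) = Suc (Suc a)" "m = Suc b"
    using W(2) m by (metis Suc_le_D numeral_2_eq_2 Suc_le_mono)
  then have "m - 1 \<le> sum q W"
    using fair[OF W(1)] sum_decrement[OF block_subset[OF W(1)]] by simp
  also have "\<dots> \<le> sum q merged" using W by (intro block_le_merged) auto
  finally show ?thesis .
qed

lemma card_blocks_meeting:
  assumes "\<And>W. W \<in> P \<Longrightarrow> card (X \<inter> W) \<le> 1"
  shows "card {W \<in> P. X \<inter> W \<noteq> {}} = card (X \<inter> K)"
proof -
  have count: "(\<Sum>j\<in>W. of_bool (j \<in> X)) = card (X \<inter> W)" if "W \<subseteq> K" for W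
    using finite_subset[OF that finite_K] by (simp add: Int_commute)
  have indicator: "card (X \<inter> W) = of_bool (X \<inter> W \<noteq> {})" if "W \<in> P" for W
  proof -
    have "finite (X \<inter> W)" using finite_subset[OF block_subset[OF that] finite_K] by simp
    then show ?thesis using assms[OF that] by (cases "X \<inter> W = {}") (auto simp: le_Suc_eq)
  qed
  have "card (X \<inter> K) = (\<Sum>j\<in>K. of_bool (j \<in> X))" using count[of K] by simp
  also have "\<dots> = (\<Sum>W\<in>P. \<Sum>j\<in>W. of_bool (j \<in> X))" by (rule sum_partition_on[OF finite_K partition])
  also have "\<dots> = (\<Sum>W\<in>P. of_bool (X \<inter> W \<noteq> {}))"
    using count block_subset indicator by (intro sum.cong refl) metis
  also have "\<dots> = card {W \<in> P. X \<inter> W \<noteq> {}}" using finite_P by (simp add: Int_def)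
  finally show ?thesis ..
qed

text \<open>Either some block meets \<open>X\<close> twice, and then the merged block alone accounts for the \<open>m - 1\<close>
  remaining vertices, or \<open>X\<close> meets \<open>card (X \<inter> K)\<close> distinct blocks, which become a single one.\<close>

lemma card_merge_meeting_le: "card (merge_meeting X P) + (m - 1) \<le> sum q K + 1"
proof (cases "\<exists>W\<in>P. 2 \<le> card (X \<inter> W)")
  case True
  then have "m - 1 \<le> sum q merged" using merged_heavy by blast
  moreover have "card untouched \<le> (\<Sum>W\<in>untouched. sum q W)"
    using sum_mono[OF untouched_pos, of untouched "\<lambda>W. W"] by simp
  moreover have "sum q K = sum q merged + (\<Sum>W\<in>untouched. sum q W)"
    using sum_partition_on[OF finite_K partition_merge_meeting, of q]
      sum_merge_meeting[OF finite_P X_meets] by simp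
  ultimately show ?thesis using card_merge_meeting by simp
next
  case False
  then have "card {W \<in> P. X \<inter> W \<noteq> {}} = card (X \<inter> K)"
    by (intro card_blocks_meeting) (force simp: not_le)
  moreover have "card P = card {W \<in> P. X \<inter> W \<noteq> {}} + card untouched"
    using finite_P by (subst card_Un_disjoint[symmetric]) (auto intro: arg_cong[where f = card])
  moreover have "card P + m \<le> sum p K + 1" using joinable by (simp add: joinable_def)
  moreover have "sum p K = sum q K + card (X \<inter> K)" using sum_decrement[of K] by simp
  ultimately show ?thesis using card_merge_meeting m by simp
qed

theorem joinable_merge_meeting: "joinable q K (m - 1) (merge_meeting X P)"
  using partition_merge_meeting merged_pos untouched_pos card_merge_meeting_le
  by (auto simp: joinable_def merge_meeting_def)

end

section \<open>Connectivity of a color\<close>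

definition linked :: "'j set \<Rightarrow> ('j \<Rightarrow> 'v multiset) \<Rightarrow> 'v \<Rightarrow> ('j \<times> 'j) set" where
  "linked K e \<alpha> = {(i, j). i \<in> K \<and> j \<in> K \<and> (\<exists>v. v \<noteq> \<alpha> \<and> v \<in># e i \<and> v \<in># e j)}"

text \<open>The members of \<open>P\<close> need not be maximal linked sets: distinct ones may share vertices
  other than \<open>\<alpha>\<close>.\<close>

definition wing_partition :: "'j set \<Rightarrow> ('j \<Rightarrow> 'v multiset) \<Rightarrow> 'v \<Rightarrow> nat \<Rightarrow> 'j set set \<Rightarrow> bool" where
  "wing_partition K e \<alpha> m P \<longleftrightarrow>
     joinable (\<lambda>j. count (e j) \<alpha>) K m P \<and> (\<forall>W\<in>P. W \<times> W \<subseteq> (linked K e \<alpha>)\<^sup>*)"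

lemma linked_rtrancl_imp_joined:
  assumes "(a, b) \<in> (linked K e \<alpha>)\<^sup>*" "a \<in> K" "u \<in># e a" "v \<in># e b"
    and E: "e ` K \<subseteq> set_mset E" and V: "\<And>j. j \<in> K \<Longrightarrow> set_mset (e j) \<subseteq> V"
  shows "(u, v) \<in> {(x, y). x \<in> V \<and> y \<in> V \<and> (\<exists>e\<in>#E. x \<in># e \<and> y \<in># e)}\<^sup>*"
  using assms(1,4)
proof (induction arbitrary: v rule: rtrancl_induct)
  case base
  then show ?case using assms(2,3) E V by (intro r_into_rtrancl) blast
next
  case (step b d)
  then obtain w where w: "w \<in># e b" "w \<in># e d" "d \<in> K" by (auto simp: linked_def)
  have "(w, v) \<in> {(x, y). x \<in> V \<and> y \<in> V \<and> (\<exists>e\<in>#E. x \<in># e \<and> y \<in># e)}"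
    using w step.prems E V by blast
  then show ?case using step.IH[OF w(1)] by (rule rtrancl_into_rtrancl[rotated])
qed

lemma wing_partition_imp_connected:
  assumes K: "finite K" and wings: "wing_partition K e \<alpha> m P"
    and V: "\<And>j. j \<in> K \<Longrightarrow> set_mset (e j) \<subseteq> V" and cover: "\<And>u. u \<in> V \<Longrightarrow> \<exists>j\<in>K. u \<in># e j"
  shows "hypergraph_connected V (image_mset e (mset_set K))"
proof -
  define R where
    "R = {(x, y). x \<in> V \<and> y \<in> V \<and> (\<exists>e\<in>#image_mset e (mset_set K). x \<in># e \<and> y \<in># e)}"
  have "sym R" by (auto simp: R_def sym_def)
  then have sym: "sym (R\<^sup>*)" by (rule sym_rtrancl)
  have to_\<alpha>: "(u, \<alpha>) \<in> R\<^sup>*" if u: "u \<in> V" for u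
  proof -
    obtain a where a: "a \<in> K" "u \<in># e a" using cover[OF u] by blast
    then obtain W where W: "W \<in> P" "a \<in> W"
      using wings by (auto simp: wing_partition_def joinable_def partition_on_def)
    then have "(\<Sum>j\<in>W. count (e j) \<alpha>) \<noteq> 0"
      using wings by (force simp: wing_partition_def joinable_def)
    then obtain b where b: "b \<in> W" "\<alpha> \<in># e b" by (metis not_in_iff sum.neutral)
    have "(a, b) \<in> (linked K e \<alpha>)\<^sup>*" using wings W b(1) by (auto simp: wing_partition_def)
    then show ?thesis
      unfolding R_def using a b(2) K V
      by (intro linked_rtrancl_imp_joined[where K = K and e = e and \<alpha> = \<alpha>]) auto
  qed
  have "(u, v) \<in> R\<^sup>*" if "u \<in> V" "v \<in> V" for u v
    using to_\<alpha>[OF that(1)] symD[OF sym to_\<alpha>[OF that(2)]] by (rule rtrancl_trans)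
  then show ?thesis unfolding hypergraph_connected_def R_def by blast
qed

lemma wing_partition_singletons:
  assumes "finite K" "2 \<le> h" "2 * m \<le> card K * h"
  shows "wing_partition K (\<lambda>_. replicate_mset h \<alpha>) \<alpha> m ((\<lambda>j. {j}) ` K)"
proof -
  have "card K * 2 \<le> card K * h" using assms(2) by simp
  then have "card K + m \<le> card K * h + 1" using assms(3) by linarith
  moreover have "card ((\<lambda>j. {j}) ` K) = card K" by (rule card_image) simp
  ultimately show ?thesis
    using assms(2) by (auto simp: wing_partition_def joinable_def partition_on_singletons)
qed

section \<open>Splitting a vertex off the amalgamated vertex\<close>

definition split_off :: "'v \<Rightarrow> 'v \<Rightarrow> 'j set \<Rightarrow> ('j \<Rightarrow> 'v multiset) \<Rightarrow> 'j \<Rightarrow> 'v multiset" where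
  "split_off \<alpha> \<beta> X e j = (if j \<in> X then add_mset \<beta> (e j - {#\<alpha>#}) else e j)"

lemma count_split_off_old:
  "\<alpha> \<noteq> \<beta> \<Longrightarrow> (j \<in> X \<Longrightarrow> \<alpha> \<in># e j) \<Longrightarrow>
    count (split_off \<alpha> \<beta> X e j) \<alpha> + of_bool (j \<in> X) = count (e j) \<alpha>"
  by (auto simp: split_off_def)

lemma count_split_off_new:
  "\<alpha> \<noteq> \<beta> \<Longrightarrow> \<beta> \<notin># e j \<Longrightarrow> count (split_off \<alpha> \<beta> X e j) \<beta> = of_bool (j \<in> X)"
  by (auto simp: split_off_def not_in_iff)

lemma count_split_off_other:
  "u \<noteq> \<alpha> \<Longrightarrow> u \<noteq> \<beta> \<Longrightarrow> count (split_off \<alpha> \<beta> X e j) u = count (e j) u"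
  by (simp add: split_off_def)

lemma linked_subset_split_off: "linked K e \<alpha> \<subseteq> linked K (split_off \<alpha> \<beta> X e) \<alpha>"
proof -
  have "v \<in># split_off \<alpha> \<beta> X e j" if "v \<noteq> \<alpha>" "v \<in># e j" for v j
    using that by (auto simp: split_off_def in_diff_count)
  then show ?thesis unfolding linked_def by blast
qed

lemma linked_split_off:
  "\<alpha> \<noteq> \<beta> \<Longrightarrow> a \<in> X \<Longrightarrow> b \<in> X \<Longrightarrow> a \<in> K \<Longrightarrow> b \<in> K \<Longrightarrow> (a, b) \<in> linked K (split_off \<alpha> \<beta> X e) \<alpha>"
  by (auto simp: linked_def split_off_def intro!: exI[of _ \<beta>])

lemma merge_meeting_linked_split_off:
  assumes "\<alpha> \<noteq> \<beta>" "\<Union>P \<subseteq> K" and wings: "\<And>W. W \<in> P \<Longrightarrow> W \<times> W \<subseteq> (linked K e \<alpha>)\<^sup>*"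
    and W: "W \<in> merge_meeting X P"
  shows "W \<times> W \<subseteq> (linked K (split_off \<alpha> \<beta> X e) \<alpha>)\<^sup>*"
proof -
  let ?R = "linked K (split_off \<alpha> \<beta> X e) \<alpha>"
  have old: "W \<times> W \<subseteq> ?R\<^sup>*" if "W \<in> P" for W
    using wings[OF that] rtrancl_mono[OF linked_subset_split_off] by (rule order.trans)
  show ?thesis
  proof (cases "W \<in> P")
    case True
    then show ?thesis by (rule old)
  next
    case False
    then have merged: "W = \<Union>{W \<in> P. X \<inter> W \<noteq> {}}" using W by (auto simp: merge_meeting_def)
    show ?thesis
    proof clarify
      fix a b assume "a \<in> W" "b \<in> W"
      then obtain A B x y where AB: "A \<in> P" "a \<in> A" "x \<in> A" "x \<in> X" "B \<in> P" "b \<in> B" "y \<in> B" "y \<in> X"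
        unfolding merged by blast
      then have "(a, x) \<in> ?R\<^sup>*" "(y, b) \<in> ?R\<^sup>*" using old by blast+
      moreover have "(x, y) \<in> ?R" using AB assms(1,2) by (intro linked_split_off) auto
      ultimately show "(a, b) \<in> ?R\<^sup>*" by (meson rtrancl.rtrancl_into_rtrancl rtrancl_trans)
    qed
  qed
qed

lemma wing_partition_split_off:
  assumes "finite K" and wings: "wing_partition K e \<alpha> m P" and "2 \<le> m" "\<alpha> \<noteq> \<beta>"
    and "\<And>j. j \<in> X \<Longrightarrow> \<alpha> \<in># e j"
    and "\<And>W. W \<in> P \<Longrightarrow> card (X \<inter> W) * m < (\<Sum>j\<in>W. count (e j) \<alpha>) + m"
    and "X \<inter> heavy_part (\<lambda>j. count (e j) \<alpha>) P \<noteq> {}"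
  shows "wing_partition K (split_off \<alpha> \<beta> X e) \<alpha> (m - 1) (merge_meeting X P)"
proof -
  interpret weight_decrement K X "\<lambda>j. count (e j) \<alpha>" "\<lambda>j. count (split_off \<alpha> \<beta> X e j) \<alpha>" m P
    using assms by unfold_locales (auto simp: wing_partition_def count_split_off_old)
  have "W \<times> W \<subseteq> (linked K (split_off \<alpha> \<beta> X e) \<alpha>)\<^sup>*" if "W \<in> merge_meeting X P" for W
    using that \<open>\<alpha> \<noteq> \<beta>\<close> wings block_subset
    by (intro merge_meeting_linked_split_off) (auto simp: wing_partition_def)
  then show ?thesis using joinable_merge_meeting by (simp add: wing_partition_def)
qed

definition admissible_edges :: "nat \<Rightarrow> 'v \<Rightarrow> 'v set \<Rightarrow> 'v multiset set" where
  "admissible_edges h \<alpha> V = {t. size t = h \<and> set_mset t \<subseteq> V \<and> (\<forall>v. v \<noteq> \<alpha> \<longrightarrow> count t v \<le> 1)}"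

lemma replicate_mset_plus_mset_set_admissible:
  assumes "finite U" "U \<subseteq> V - {\<alpha>}" "\<alpha> \<in> V"
  shows "replicate_mset p \<alpha> + mset_set U \<in> admissible_edges (card U + p) \<alpha> V"
  using assms by (auto simp: admissible_edges_def count_mset_set' split: if_splits)

lemma admissible_edges_singleton: "admissible_edges h \<alpha> {\<alpha>} = {replicate_mset h \<alpha>}"
  by (auto simp: admissible_edges_def dest: set_mset_subset_singletonD split: if_splits)

lemma admissible_edges_insert:
  "admissible_edges h \<alpha> V \<subseteq> admissible_edges h \<alpha> (insert \<beta> V)"
  "t \<in> admissible_edges h \<alpha> (insert \<beta> V) \<Longrightarrow> \<beta> \<notin># t \<Longrightarrow> t \<in> admissible_edges h \<alpha> V"
  by (auto simp: admissible_edges_def)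

lemma split_edge_admissible:
  assumes "t \<in> admissible_edges h \<alpha> V" "\<alpha> \<in># t" "\<beta> \<notin> V"
  shows "add_mset \<beta> (t - {#\<alpha>#}) \<in> admissible_edges h \<alpha> (insert \<beta> V)"
proof -
  have "count t \<beta> = 0" using assms by (auto simp: admissible_edges_def count_eq_zero_iff)
  moreover have "size (add_mset \<beta> (t - {#\<alpha>#})) = size t"
    using assms(2) by (metis insert_DiffM size_add_mset)
  ultimately show ?thesis using assms by (auto simp: admissible_edges_def dest: in_diffD)
qed

lemma merged_edge_admissible:
  assumes "t \<in> admissible_edges h \<alpha> (insert \<beta> V)" "\<beta> \<in># t" "\<alpha> \<in> V" "\<alpha> \<noteq> \<beta>"
  shows "add_mset \<alpha> (t - {#\<beta>#}) \<in> admissible_edges h \<alpha> V"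
proof -
  have "count t \<beta> \<le> 1" using assms by (simp add: admissible_edges_def)
  then have "count t \<beta> = 1" using assms(2) by (auto simp: le_Suc_eq count_eq_zero_iff)
  then have "\<beta> \<notin># t - {#\<beta>#}" by (simp add: not_in_iff)
  moreover have "size (add_mset \<alpha> (t - {#\<beta>#})) = size t"
    using assms(2) by (metis insert_DiffM size_add_mset)
  ultimately show ?thesis using assms by (auto simp: admissible_edges_def dest: in_diffD)
qed

section \<open>Colored amalgams of complete uniform hypergraphs\<close>

text \<open>Edges are indexed by \<open>J\<close>, which together with the coloring \<open>c\<close> stays fixed while vertices are
  split off; only the edges \<open>e j\<close> change. In an amalgam the vertex \<open>\<alpha>\<close> stands for \<open>m\<close> vertices;
  \<open>D\<close> is the set of colors that are kept connected.\<close>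

locale colored_edges =
  fixes J :: "'j set" and c :: "'j \<Rightarrow> nat" and I :: "nat set" and r :: "nat \<Rightarrow> nat"
    and h lam :: nat and \<alpha> :: 'v
  assumes finite_J: "finite J" and finite_I: "finite I" and colors: "c ` J \<subseteq> I"
begin

definition color_edges :: "nat \<Rightarrow> 'j set" where
  "color_edges i = {j \<in> J. c j = i}"

definition amalgam :: "'v set \<Rightarrow> nat \<Rightarrow> ('j \<Rightarrow> 'v multiset) \<Rightarrow> bool" where
  "amalgam V m e \<longleftrightarrow> \<alpha> \<in> V \<and>
     (\<forall>j\<in>J. e j \<in> admissible_edges h \<alpha> V) \<and>
     (\<forall>t\<in>admissible_edges h \<alpha> V. card {j \<in> J. e j = t} = lam * (m choose count t \<alpha>)) \<and>
     (\<forall>i\<in>I. \<forall>u\<in>V. (\<Sum>j\<in>color_edges i. count (e j) u) = (if u = \<alpha> then r i * m else r i))"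

definition color_blocks :: "('j \<Rightarrow> nat) \<Rightarrow> nat set \<Rightarrow> (nat \<Rightarrow> 'j set set) \<Rightarrow> 'j set set" where
  "color_blocks p D P =
     (\<Union>i\<in>I. insert (color_edges i) (if i \<in> D then insert (heavy_part p (P i)) (P i) else {}))"

definition splitting_sample :: "nat \<Rightarrow> ('j \<Rightarrow> 'v multiset) \<Rightarrow> nat set \<Rightarrow> (nat \<Rightarrow> 'j set set) \<Rightarrow>
    'j set \<Rightarrow> bool" where
  "splitting_sample m e D P X \<longleftrightarrow> X \<subseteq> J \<and> (\<forall>j\<in>X. \<alpha> \<in># e j) \<and>
     fair_sample (range (\<lambda>t. {j \<in> J. e j = t}) \<union> color_blocks (\<lambda>j. count (e j) \<alpha>) D P)
       (\<lambda>j. count (e j) \<alpha>) m X"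

lemma finite_color_edges: "finite (color_edges i)"
  using finite_J by (simp add: color_edges_def)

lemma laminar_color_blocks:
  assumes part: "\<And>i. i \<in> D \<Longrightarrow> partition_on (color_edges i) (P i)"
  shows "color_blocks p D P \<subseteq> Pow J" "laminar (color_blocks p D P)"
proof -
  define \<F> where "\<F> i = (if i \<in> D then insert (heavy_part p (P i)) (P i) else {})" for i
  have sub: "\<F> i \<subseteq> Pow (color_edges i)" for i
    using part[of i] by (auto simp: \<F>_def partition_on_def heavy_part_def)
  then show "color_blocks p D P \<subseteq> Pow J"
    unfolding color_blocks_def \<F>_def[symmetric] by (auto simp: color_edges_def)
  have "laminar (\<F> i)" for i
  proof (cases "i \<in> D")
    case True
    have "laminar (insert (\<Union>{W \<in> P i. 2 \<le> sum p W}) (P i))"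
      using part[OF True] by (intro disjoint_imp_laminar_insert_Union) (auto simp: partition_on_def)
    then show ?thesis using True by (simp add: \<F>_def heavy_part_def)
  qed (simp add: \<F>_def laminar_def)
  then have "laminar (insert (color_edges i) (\<F> i))" for i
    using sub by (intro laminar_insert_superset)
  then show "laminar (color_blocks p D P)"
    unfolding color_blocks_def \<F>_def[symmetric] using sub
    by (intro laminar_UN[where K = color_edges])
      (auto simp: disjoint_family_on_def color_edges_def)
qed

lemma amalgam_color_degree:
  "amalgam V m e \<Longrightarrow> i \<in> I \<Longrightarrow> u \<in> V \<Longrightarrow>
    (\<Sum>j\<in>color_edges i. count (e j) u) = (if u = \<alpha> then r i * m else r i)"
  by (simp add: amalgam_def)

lemma amalgam_edge_class_dvd:
  assumes "amalgam V m e"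
  shows "m dvd (\<Sum>j | j \<in> J \<and> e j = t. count (e j) \<alpha>)"
proof (cases "{j \<in> J. e j = t} = {}")
  case False
  then have "t \<in> admissible_edges h \<alpha> V" using assms by (auto simp: amalgam_def)
  then have "(\<Sum>j | j \<in> J \<and> e j = t. count (e j) \<alpha>) = lam * (count t \<alpha> * (m choose count t \<alpha>))"
    using assms by (simp add: amalgam_def)
  also have "m dvd \<dots>" by (cases "count t \<alpha> = 0") (auto simp: times_binomial_minus1_eq)
  finally show ?thesis .
qed (simp only: sum.empty dvd_0_right)

lemma amalgam_count_le:
  assumes "amalgam V m e" "j \<in> J"
  shows "count (e j) \<alpha> \<le> m"
proof (rule ccontr)
  assume "\<not> count (e j) \<alpha> \<le> m"
  then have "card {i \<in> J. e i = e j} = 0" using assms by (simp add: amalgam_def)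
  then show False using finite_J assms(2) by auto
qed

lemma splitting_sample_exists:
  assumes am: "amalgam V m e" and m: "0 < m"
    and wings: "\<And>i. i \<in> D \<Longrightarrow> wing_partition (color_edges i) e \<alpha> m (P i)"
  shows "\<exists>X. splitting_sample m e D P X"
proof -
  let ?p = "\<lambda>j. count (e j) \<alpha>" and ?\<A> = "range (\<lambda>t. {j \<in> J. e j = t})"
  have A: "?\<A> \<subseteq> Pow J" "laminar ?\<A>" by (auto simp: laminar_def)
  have B: "color_blocks ?p D P \<subseteq> Pow J" "laminar (color_blocks ?p D P)"
    using wings by (auto intro!: laminar_color_blocks simp: wing_partition_def joinable_def)
  have "sum ?p J = (\<Sum>i\<in>I. sum ?p (color_edges i))"
    unfolding color_edges_def using finite_J finite_I colors by (intro sum.group[symmetric])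
  also have "\<dots> = (\<Sum>i\<in>I. r i * m)" using am by (intro sum.cong) (auto simp: amalgam_def)
  finally have dvd: "m dvd sum ?p J" by (simp add: dvd_sum)
  obtain X where "X \<subseteq> J" "\<And>j. j \<in> X \<Longrightarrow> 0 < ?p j"
    "fair_sample (?\<A> \<union> color_blocks ?p D P) ?p m X"
    using laminar_fair_sample[OF finite_J A B m dvd amalgam_count_le[OF am]] by blast
  then show ?thesis by (auto simp: splitting_sample_def)
qed

end

locale amalgam_splitting = colored_edges J c I r h lam \<alpha>
  for J :: "'j set" and c :: "'j \<Rightarrow> nat" and I :: "nat set" and r :: "nat \<Rightarrow> nat"
    and h lam :: nat and \<alpha> :: 'v +
  fixes V :: "'v set" and m :: nat and e :: "'j \<Rightarrow> 'v multiset" and \<beta> :: 'v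
    and D :: "nat set" and P :: "nat \<Rightarrow> 'j set set" and X :: "'j set"
  assumes amalgam: "amalgam V m e" and m: "2 \<le> m" and \<beta>: "\<beta> \<notin> V" and D: "D \<subseteq> I"
    and wings: "\<And>i. i \<in> D \<Longrightarrow> wing_partition (color_edges i) e \<alpha> m (P i)"
    and sample: "splitting_sample m e D P X"
begin

lemma X_subset: "X \<subseteq> J"
  using sample by (simp add: splitting_sample_def)

lemma \<alpha>_in_sample: "j \<in> X \<Longrightarrow> \<alpha> \<in># e j"
  using sample by (simp add: splitting_sample_def)

lemma fair: "fair_sample (range (\<lambda>t. {j \<in> J. e j = t}) \<union> color_blocks (\<lambda>j. count (e j) \<alpha>) D P)
    (\<lambda>j. count (e j) \<alpha>) m X"
  using sample by (simp add: splitting_sample_def)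

lemma \<alpha>_neq_\<beta>: "\<alpha> \<noteq> \<beta>"
  using amalgam \<beta> by (auto simp: amalgam_def)

lemma \<beta>_notin_edge: "j \<in> J \<Longrightarrow> \<beta> \<notin># e j"
  using amalgam \<beta> by (auto simp: amalgam_def admissible_edges_def)

lemma color_degree_\<alpha>: "i \<in> I \<Longrightarrow> (\<Sum>j\<in>color_edges i. count (e j) \<alpha>) = r i * m"
  using amalgam by (simp add: amalgam_def)

lemma card_sample_color:
  assumes "i \<in> I"
  shows "card (X \<inter> color_edges i) = r i"
proof -
  have "card (X \<inter> color_edges i) * m = r i * m"
    using fair_sample_exact[OF fair, of "color_edges i"] color_degree_\<alpha>[OF assms] assms
    by (auto simp: color_blocks_def)
  then show ?thesis using m by simp
qed

lemma card_sample_edge_class: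
  assumes "t \<in> admissible_edges h \<alpha> V"
  shows "card {j \<in> X. e j = t} =
    (if count t \<alpha> = 0 then 0 else lam * ((m - 1) choose (count t \<alpha> - 1)))"
proof -
  have "X \<inter> {j \<in> J. e j = t} = {j \<in> X. e j = t}" using X_subset by blast
  then have "card {j \<in> X. e j = t} * m = (\<Sum>j | j \<in> J \<and> e j = t. count (e j) \<alpha>)"
    using fair_sample_exact[OF fair, of "{j \<in> J. e j = t}"] amalgam_edge_class_dvd[OF amalgam]
    by auto
  also have "\<dots> = lam * (count t \<alpha> * (m choose count t \<alpha>))"
    using amalgam assms by (simp add: amalgam_def)
  also have "\<dots> = (if count t \<alpha> = 0 then 0 else lam * ((m - 1) choose (count t \<alpha> - 1))) * m"
    by (simp add: times_binomial_minus1_eq)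
  finally show ?thesis using m by (simp only: mult_cancel2) simp
qed

lemma split_off_admissible:
  assumes "j \<in> J"
  shows "split_off \<alpha> \<beta> X e j \<in> admissible_edges h \<alpha> (insert \<beta> V)"
proof -
  have "e j \<in> admissible_edges h \<alpha> V" using amalgam assms by (simp add: amalgam_def)
  then show ?thesis
    using \<alpha>_in_sample[of j] \<beta> admissible_edges_insert(1)[of h \<alpha> V \<beta>] split_edge_admissible[of "e j"]
    by (auto simp: split_off_def)
qed

lemma card_edge_class_split_off_old:
  assumes t: "t \<in> admissible_edges h \<alpha> V"
  shows "card {j \<in> J. split_off \<alpha> \<beta> X e j = t} = lam * ((m - 1) choose count t \<alpha>)"
proof -
  have "\<beta> \<notin># t" using t \<beta> by (auto simp: admissible_edges_def)
  moreover have "\<beta> \<in># split_off \<alpha> \<beta> X e j" if "j \<in> X" for j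
    using that by (simp add: split_off_def)
  ultimately have "split_off \<alpha> \<beta> X e j = t \<longleftrightarrow> j \<notin> X \<and> e j = t" for j
    by (cases "j \<in> X") (auto simp: split_off_def)
  then have "{j \<in> J. split_off \<alpha> \<beta> X e j = t} = {j \<in> J. e j = t} - {j \<in> X. e j = t}" by blast
  then have "card {j \<in> J. split_off \<alpha> \<beta> X e j = t} = card {j \<in> J. e j = t} - card {j \<in> X. e j = t}"
    using X_subset finite_J by (subst card_Diff_subset[symmetric]) (auto intro: finite_subset)
  also have "\<dots> = lam * (m choose count t \<alpha>) -
      (if count t \<alpha> = 0 then 0 else lam * ((m - 1) choose (count t \<alpha> - 1)))"
    using amalgam t card_sample_edge_class[OF t] by (simp add: amalgam_def)
  also have "\<dots> = lam * ((m - 1) choose count t \<alpha>)"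
  proof -
    obtain m' where "m = Suc m'" using m by (cases m) auto
    then show ?thesis by (cases "count t \<alpha>") (auto simp: add_mult_distrib2)
  qed
  finally show ?thesis .
qed

lemma card_edge_class_split_off_new:
  assumes t: "t \<in> admissible_edges h \<alpha> (insert \<beta> V)" "\<beta> \<in># t"
  shows "card {j \<in> J. split_off \<alpha> \<beta> X e j = t} = lam * ((m - 1) choose count t \<alpha>)"
proof -
  let ?s = "add_mset \<alpha> (t - {#\<beta>#})"
  have "split_off \<alpha> \<beta> X e j = t \<longleftrightarrow> j \<in> X \<and> e j = ?s" if "j \<in> J" for j
  proof (cases "j \<in> X")
    case True
    have "add_mset \<beta> (e j - {#\<alpha>#}) = t \<longleftrightarrow> e j = ?s"
      using \<alpha>_in_sample[OF True] t(2) by (metis add_mset_remove_trivial insert_DiffM)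
    then show ?thesis using True by (simp add: split_off_def)
  next
    case False
    then show ?thesis using \<beta>_notin_edge[OF that] t(2) by (auto simp: split_off_def)
  qed
  then have "{j \<in> J. split_off \<alpha> \<beta> X e j = t} = {j \<in> X. e j = ?s}" using X_subset by blast
  moreover have "?s \<in> admissible_edges h \<alpha> V"
    using t \<alpha>_neq_\<beta> amalgam by (intro merged_edge_admissible) (auto simp: amalgam_def)
  moreover have "count ?s \<alpha> = Suc (count t \<alpha>)" using \<alpha>_neq_\<beta> by simp
  ultimately show ?thesis using card_sample_edge_class[of ?s] by simp
qed

lemma color_degree_split_off:
  assumes i: "i \<in> I" and u: "u \<in> insert \<beta> V"
  shows "(\<Sum>j\<in>color_edges i. count (split_off \<alpha> \<beta> X e j) u) = (if u = \<alpha> then r i * (m - 1) else r i)"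
proof -
  have sampled: "(\<Sum>j\<in>color_edges i. of_bool (j \<in> X)) = r i"
    using card_sample_color[OF i] finite_color_edges by (simp add: Int_commute)
  consider "u = \<alpha>" | "u = \<beta>" | "u \<in> V" "u \<noteq> \<alpha>" "u \<noteq> \<beta>" using u by blast
  then show ?thesis
  proof cases
    case 1
    have "(\<Sum>j\<in>color_edges i. count (split_off \<alpha> \<beta> X e j) \<alpha>) + r i
        = (\<Sum>j\<in>color_edges i. count (split_off \<alpha> \<beta> X e j) \<alpha> + of_bool (j \<in> X))"
      by (simp only: sum.distrib sampled)
    also have "\<dots> = r i * m"
      using \<alpha>_neq_\<beta> \<alpha>_in_sample color_degree_\<alpha>[OF i] by (simp add: count_split_off_old)
    finally show ?thesis using 1 m by (cases m) auto
  next
    case 2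
    have "(\<Sum>j\<in>color_edges i. count (split_off \<alpha> \<beta> X e j) \<beta>) = (\<Sum>j\<in>color_edges i. of_bool (j \<in> X))"
      using \<alpha>_neq_\<beta> \<beta>_notin_edge
      by (intro sum.cong count_split_off_new) (auto simp: color_edges_def)
    then show ?thesis using 2 sampled \<alpha>_neq_\<beta> by simp
  next
    case 3
    then show ?thesis
      using amalgam_color_degree[OF amalgam i 3(1)] by (simp add: count_split_off_other)
  qed
qed

lemma amalgam_split_off: "amalgam (insert \<beta> V) (m - 1) (split_off \<alpha> \<beta> X e)"
proof -
  have "card {j \<in> J. split_off \<alpha> \<beta> X e j = t} = lam * ((m - 1) choose count t \<alpha>)"
    if t: "t \<in> admissible_edges h \<alpha> (insert \<beta> V)" for t
  proof (cases "\<beta> \<in># t")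
    case True
    with t show ?thesis by (rule card_edge_class_split_off_new)
  next
    case False
    with t have "t \<in> admissible_edges h \<alpha> V" by (rule admissible_edges_insert(2))
    then show ?thesis by (rule card_edge_class_split_off_old)
  qed
  moreover have "\<alpha> \<in> insert \<beta> V" using amalgam by (simp add: amalgam_def)
  ultimately show ?thesis
    using split_off_admissible color_degree_split_off by (simp add: amalgam_def)
qed

lemma wing_partition_color_split_off:
  assumes i: "i \<in> D"
  shows "wing_partition (color_edges i) (split_off \<alpha> \<beta> X e) \<alpha> (m - 1) (merge_meeting X (P i))"
proof -
  let ?p = "\<lambda>j. count (e j) \<alpha>"
  have blocks: "insert (heavy_part ?p (P i)) (P i) \<subseteq> color_blocks ?p D P"
    using i D by (auto simp: color_blocks_def)
  have "m \<le> sum ?p (heavy_part ?p (P i))"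
    using wings[OF i] heavy_part_weight[OF finite_color_edges _ m]
    by (auto simp: wing_partition_def)
  then have "X \<inter> heavy_part ?p (P i) \<noteq> {}"
    using blocks by (intro fair_sample_meets[OF fair]) auto
  moreover have "card (X \<inter> W) * m < sum ?p W + m" if "W \<in> P i" for W
    using fair blocks that by (auto simp: fair_sample_def)
  ultimately show ?thesis
    using wing_partition_split_off[OF finite_color_edges wings[OF i] m \<alpha>_neq_\<beta> \<alpha>_in_sample] by blast
qed

end

context colored_edges
begin

lemma card_edges:
  assumes "0 < h" "(\<Sum>i\<in>I. r i) = lam * ((n - 1) choose (h - 1))"
    and "\<And>i. i \<in> I \<Longrightarrow> card (color_edges i) * h = r i * n"
  shows "card J = lam * (n choose h)"
proof -
  have "card J = (\<Sum>i\<in>I. card (color_edges i))"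
    unfolding color_edges_def using sum.group[OF finite_J finite_I colors, of "\<lambda>_. 1::nat"] by simp
  then have "h * card J = (\<Sum>i\<in>I. r i * n)"
    using assms(3) by (simp add: sum_distrib_left mult.commute)
  also have "\<dots> = lam * (n * ((n - 1) choose (h - 1)))"
    using assms(2) by (simp flip: sum_distrib_right)
  also have "\<dots> = h * (lam * (n choose h))"
    using times_binomial_minus1_eq[OF \<open>0 < h\<close>, of n] by simp
  finally show ?thesis using \<open>0 < h\<close> by simp
qed

lemma amalgam_singleton:
  assumes "card J = lam * (n choose h)" "\<And>i. i \<in> I \<Longrightarrow> card (color_edges i) * h = r i * n"
  shows "amalgam {\<alpha>} n (\<lambda>_. replicate_mset h \<alpha>)"
  using assms by (simp add: amalgam_def admissible_edges_singleton)

theorem amalgam_exists: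
  assumes "finite B" "\<alpha> \<notin> B" "card B < n" "D \<subseteq> I"
    and "0 < h" "(\<Sum>i\<in>I. r i) = lam * ((n - 1) choose (h - 1))"
    and card_color: "\<And>i. i \<in> I \<Longrightarrow> card (color_edges i) * h = r i * n"
    and connectable: "\<And>i. i \<in> D \<Longrightarrow> 2 \<le> h \<and> 2 \<le> r i"
  shows "\<exists>e P. amalgam (insert \<alpha> B) (n - card B) e \<and>
    (\<forall>i\<in>D. wing_partition (color_edges i) e \<alpha> (n - card B) (P i))"
  using assms(1,2,3)
proof (induction B rule: finite_induct)
  case empty
  have "wing_partition (color_edges i) (\<lambda>_. replicate_mset h \<alpha>) \<alpha> n ((\<lambda>j. {j}) ` color_edges i)"
    if "i \<in> D" for i
    using that connectable[OF that] card_color[of i] \<open>D \<subseteq> I\<close>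
    by (intro wing_partition_singletons finite_color_edges) auto
  then show ?case using amalgam_singleton[OF card_edges[OF assms(5,6) card_color] card_color]
    by (intro exI[of _ "\<lambda>_. replicate_mset h \<alpha>"] exI[of _ "\<lambda>i. (\<lambda>j. {j}) ` color_edges i"]) simp
next
  case (insert \<beta> B)
  then obtain e P where am: "amalgam (insert \<alpha> B) (n - card B) e"
    and wings: "\<And>i. i \<in> D \<Longrightarrow> wing_partition (color_edges i) e \<alpha> (n - card B) (P i)" by auto
  have "0 < n - card B" using insert by simp
  then obtain X where sample: "splitting_sample (n - card B) e D P X"
    using splitting_sample_exists[OF am _ wings] by blast
  interpret amalgam_splitting J c I r h lam \<alpha> "insert \<alpha> B" "n - card B" e \<beta> D P X
  proof unfold_locales
    show "2 \<le> n - card B" "\<beta> \<notin> insert \<alpha> B" using insert by auto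
  qed (fact am wings sample \<open>D \<subseteq> I\<close>)+
  have "n - card (insert \<beta> B) = n - card B - 1" using insert by simp
  then show ?case
    using amalgam_split_off wing_partition_color_split_off
    by (intro exI[of _ "split_off \<alpha> \<beta> X e"] exI[of _ "\<lambda>i. merge_meeting X (P i)"])
      (simp add: insert_commute)
qed

end

section \<open>From indexed edges to colored hypergraphs\<close>

lemma count_image_mset_mset_set:
  "finite J \<Longrightarrow> count (image_mset e (mset_set J)) t = card {j \<in> J. e j = t}"
  by (simp add: count_image_mset vimage_def Int_def conj_commute)

lemma vertex_degree_image_mset:
  "vertex_degree (image_mset e (mset_set K)) u = (\<Sum>j\<in>K. count (e j) u)"
  by (simp add: vertex_degree_def multiset.map_comp comp_def flip: sum_unfold_sum_mset)

lemma hypergraph_connected_singleton: "hypergraph_connected {v} E"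
  by (simp add: hypergraph_connected_def)

context colored_edges
begin

definition edges :: "('j \<Rightarrow> 'v multiset) \<Rightarrow> 'v multiset multiset" where
  "edges e = image_mset e (mset_set J)"

definition coloring :: "('j \<Rightarrow> 'v multiset) \<Rightarrow> ('v multiset \<times> nat) multiset" where
  "coloring e = image_mset (\<lambda>j. (e j, c j)) (mset_set J)"

lemma edge_coloring_coloring:
  assumes "I \<subseteq> {1..k}"
  shows "edge_coloring k (edges e) (coloring e)"
proof -
  have "c ` J \<subseteq> {1..k}" using colors assms by (rule order.trans)
  then show ?thesis
    using finite_J
    by (auto simp: edge_coloring_def edges_def coloring_def multiset.map_comp comp_def)
qed

lemma color_class_coloring: "color_class (coloring e) i = image_mset e (mset_set (color_edges i))"
  using finite_J
  by (simp add: color_class_def coloring_def color_edges_def filter_mset_image_mset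
      multiset.map_comp comp_def)

lemma amalgam_hypergraph:
  assumes "amalgam V m e" "finite V"
  shows "hypergraph V (edges e)" "uniform_edges h (edges e)"
  using assms finite_J
  by (auto simp: amalgam_def admissible_edges_def hypergraph_def uniform_edges_def edges_def)

lemma amalgam_vertex_degree:
  assumes "amalgam V m e" "u \<in> V" "i \<in> I"
  shows "vertex_degree (color_class (coloring e) i) u = (if u = \<alpha> then r i * m else r i)"
  unfolding color_class_coloring vertex_degree_image_mset
  using assms(1,3,2) by (rule amalgam_color_degree)

lemma amalgam_edge_multiplicity:
  assumes "amalgam V m e" "finite V" "U \<subseteq> V - {\<alpha>}" "card U + p = h"
  shows "count (edges e) (replicate_mset p \<alpha> + mset_set U) = lam * (m choose p)"
proof -
  have "finite U" "\<alpha> \<in> V" using assms by (auto simp: amalgam_def intro: finite_subset)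
  then have "replicate_mset p \<alpha> + mset_set U \<in> admissible_edges h \<alpha> V"
    using replicate_mset_plus_mset_set_admissible[of U V \<alpha> p] assms(3,4) by simp
  moreover have "count (replicate_mset p \<alpha> + mset_set U) \<alpha> = p"
    using assms(3) by (auto simp: count_mset_set')
  ultimately show ?thesis
    using assms(1) finite_J by (simp add: amalgam_def edges_def count_image_mset_mset_set)
qed

lemma amalgam_connected:
  assumes "amalgam V m e" "0 < m" "i \<in> I" "0 < r i" "wing_partition (color_edges i) e \<alpha> m P"
  shows "hypergraph_connected V (color_class (coloring e) i)"
  unfolding color_class_coloring
proof (rule wing_partition_imp_connected[OF finite_color_edges assms(5)])
  show "set_mset (e j) \<subseteq> V" if "j \<in> color_edges i" for j
    using that assms(1) by (auto simp: amalgam_def admissible_edges_def color_edges_def)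
next
  fix u assume "u \<in> V"
  then have "(\<Sum>j\<in>color_edges i. count (e j) u) \<noteq> 0"
    using assms(2,4) by (simp add: amalgam_color_degree[OF assms(1,3)])
  then show "\<exists>j\<in>color_edges i. u \<in># e j" by (metis not_in_iff sum.neutral)
qed

end

theorem theorem3p2:
  fixes n h lam k l :: nat and r :: "nat \<Rightarrow> nat"
  assumes "n > 0" and "h > 0" and "lam > 0" and "k > 0"
    and "\<forall>i\<in>{1..k}. r i > 0"
    and "n > h"
    and "\<forall>i\<in>{1..k}. r i \<ge> 2 \<and> h dvd r i * n"
    and "(\<Sum>i = 1..k. r i) = lam * ((n - 1) choose (h - 1))"
    and "1 \<le> l" and "l \<le> n"
  shows "\<exists>(V :: nat set) E \<alpha> C.
      hypergraph V E \<and> uniform_edges h E \<and> card V = l \<and> \<alpha> \<in> V \<and> edge_coloring k E C \<and>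
      (\<forall>u\<in>V. \<forall>i\<in>{1..k}. vertex_degree (color_class C i) u =
         (if u = \<alpha> then r i * (n - l + 1) else r i)) \<and>
      (\<forall>p U. U \<subseteq> V - {\<alpha>} \<and> card U + p = h \<longrightarrow>
         count E (replicate_mset p \<alpha> + mset_set U) = lam * ((n - l + 1) choose p)) \<and>
      (\<forall>i\<in>{1..k}. r i \<ge> 2 \<and> (h \<ge> 2 \<or> l = 1) \<longrightarrow> hypergraph_connected V (color_class C i))"
proof -
  define J where "J = (SIGMA i:{1..k}. {..<r i * n div h})"
  define D where "D = {i \<in> {1..k}. 2 \<le> h}"
  define V where "V = insert (0::nat) {1..<l}"
  have V: "finite V" "card V = l" "0 \<in> V" using assms(9) by (auto simp: V_def)
  interpret colored_edges J fst "{1..k}" r h lam "0::nat"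
    by unfold_locales (auto simp: J_def)
  have "color_edges i = {i} \<times> {..<r i * n div h}" if "i \<in> {1..k}" for i
    unfolding color_edges_def using that by (auto simp: J_def)
  then have "card (color_edges i) * h = r i * n" if "i \<in> {1..k}" for i
    using that assms(7) by simp
  moreover have m: "n - l + 1 = n - card {1..<l}" using assms(9,10) by simp
  ultimately have "\<exists>e P. amalgam V (n - l + 1) e \<and>
      (\<forall>i\<in>D. wing_partition (color_edges i) e 0 (n - l + 1) (P i))"
    unfolding V_def m using assms by (intro amalgam_exists) (auto simp: D_def)
  then obtain e P where am: "amalgam V (n - l + 1) e"
    and wings: "\<forall>i\<in>D. wing_partition (color_edges i) e 0 (n - l + 1) (P i)" by blast
  have "hypergraph_connected V (color_class (coloring e) i)" if "i \<in> {1..k}" "h \<ge> 2 \<or> l = 1" for i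
    using that assms(5) amalgam_connected[OF am] wings hypergraph_connected_singleton
    by (cases "l = 1") (auto simp: D_def V_def)
  then show ?thesis
    using amalgam_hypergraph[OF am V(1)] amalgam_edge_multiplicity[OF am V(1)] V
      amalgam_vertex_degree[OF am] edge_coloring_coloring[OF order.refl]
    by (intro exI[of _ V] exI[of _ "edges e"] exI[of _ 0] exI[of _ "coloring e"]) simp
qed

end
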